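(* Let $R$ be a mid ring and $\mathfrak{p}$ be a prime ideal of $R$. Then $\mathfrak{p}$ is N-pure if and only if $\mathfrak{p}$ is a minimal prime ideal of $R$.
   Context: All rings are commutative with identity. $\mathfrak{N}$ denotes the nil-radical of $R$, and $\mathrm{Ann}(a)=\{r\in R: ra=0\}$. An ideal $I$ of $R$ is called N-pure if for every $a\in I$ there exists $b\in I$ such that $a(1-b)\in\mathfrak{N}$. A ring $R$ is called a mid ring if for every $a\in R$, $\mathrm{Ann}(a)$ is an N-pure ideal. *)

theory Defs
  imports "HOL-Algebra.Ideal"
begin

definition nilradical :: "('a, 'b) ring_scheme \<Rightarrow> 'a set" where
  "nilradical R = {x \<in> carrier R. \<exists>n::nat. x [^]\<^bsub>R\<^esub> n = \<zero>\<^bsub>R\<^esub>}"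

definition annihilator :: "('a, 'b) ring_scheme \<Rightarrow> 'a \<Rightarrow> 'a set" where
  "annihilator R a = {r \<in> carrier R. r \<otimes>\<^bsub>R\<^esub> a = \<zero>\<^bsub>R\<^esub>}"

definition N_pure_ideal :: "('a, 'b) ring_scheme \<Rightarrow> 'a set \<Rightarrow> bool" where
  "N_pure_ideal R I \<longleftrightarrow>
     ideal I R \<and> (\<forall>a\<in>I. \<exists>b\<in>I. a \<otimes>\<^bsub>R\<^esub> (\<one>\<^bsub>R\<^esub> \<ominus>\<^bsub>R\<^esub> b) \<in> nilradical R)"

definition mid_ring :: "('a, 'b) ring_scheme \<Rightarrow> bool" where
  "mid_ring R \<longleftrightarrow> cring R \<and> (\<forall>a\<in>carrier R. N_pure_ideal R (annihilator R a))"

definition minimal_prime_ideal :: "('a, 'b) ring_scheme \<Rightarrow> 'a set \<Rightarrow> bool" where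
  "minimal_prime_ideal R P \<longleftrightarrow>
     primeideal P R \<and> (\<forall>Q. primeideal Q R \<longrightarrow> Q \<subseteq> P \<longrightarrow> Q = P)"

end

theory Submission
  imports Defs "HOL-Algebra.Ring_Divisibility"
begin

text \<open>
  If \<open>P\<close> is N-pure and \<open>Q \<subseteq> P\<close> is prime, then for \<open>a \<in> P\<close> some nilpotent \<open>a (1 - b)\<close> with
  \<open>b \<in> P\<close> lies in \<open>Q\<close>; as \<open>1 - b \<notin> P\<close>, this forces \<open>a \<in> Q\<close>.
  Conversely, if \<open>P\<close> is a minimal prime and \<open>a \<in> P\<close>, then the multiplicative set of all
  \<open>s a\<^sup>n\<close> with \<open>s \<notin> P\<close> contains 0, since otherwise a prime ideal avoiding it would be strictly
  smaller than \<open>P\<close>. So \<open>s \<in> Ann(a\<^sup>n)\<close> for some \<open>s \<notin> P\<close>, and N-purity yields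
  \<open>t \<in> Ann(a\<^sup>n)\<close> with \<open>s (1 - t)\<close> nilpotent. Hence \<open>b = 1 - t\<close> lies in \<open>P\<close>, while
  \<open>a (1 - b) = a t\<close> is nilpotent.
\<close>

lemma (in cring) add_cgenideal_mem_iff:
  assumes "ideal I R" and "a \<in> carrier R"
  shows "x \<in> I <+>\<^bsub>R\<^esub> PIdl a \<longleftrightarrow> (\<exists>m\<in>I. \<exists>r\<in>carrier R. x = m \<oplus> r \<otimes> a)"
  unfolding set_add_def' cgenideal_def by blast

text \<open>Krull's argument: Zorn gives an ideal \<open>M\<close> maximal among those disjoint from
  \<open>S\<close>. For \<open>a\<close> and \<open>b\<close> outside \<open>M\<close>, the larger
  ideals \<open>M + (a)\<close> and \<open>M + (b)\<close> both meet \<open>S\<close>. The product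
  of the two meeting points is again in \<open>S\<close>, hence not in \<open>M\<close>, which rules
  out \<open>a \<otimes> b \<in> M\<close>.\<close>

lemma (in cring) exists_primeideal_disjoint:
  assumes S: "S \<subseteq> carrier R" "\<one> \<in> S" "\<zero> \<notin> S"
    and mult: "\<And>x y. \<lbrakk>x \<in> S; y \<in> S\<rbrakk> \<Longrightarrow> x \<otimes> y \<in> S"
  obtains Q where "primeideal Q R" "Q \<inter> S = {}"
proof -
  let ?A = "{I. ideal I R \<and> I \<inter> S = {}}"
  have "\<exists>M\<in>?A. \<forall>X\<in>?A. M \<subseteq> X \<longrightarrow> X = M"
  proof (rule subset_Zorn_nonempty)
    \<comment> \<open>The zero ideal is a member, since \<open>S\<close> avoids 0.\<close>
    show "?A \<noteq> {}"
      using zeroideal S(3) by blast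
    fix C assume "C \<noteq> {}" and C: "subset.chain ?A C"
    moreover have "subset.chain {I. ideal I R} C"
      using C unfolding subset_chain_def by blast
    ultimately have "ideal (\<Union>C) R"
      using chain_Union_is_ideal[of C] by simp
    then show "\<Union>C \<in> ?A"
      using C unfolding subset_chain_def by blast
  qed
  then obtain M where "M \<in> ?A" and maxA: "\<forall>X\<in>?A. M \<subseteq> X \<longrightarrow> X = M" ..
  then have M: "ideal M R" "M \<inter> S = {}" by auto
  have max: "X = M" if "ideal X R" "X \<inter> S = {}" "M \<subseteq> X" for X
    using maxA that by simp
  interpret M: ideal M R by (rule M(1))
  have zero: "\<zero> \<in> M"
    by (rule additive_subgroup.zero_closed[OF M.is_additive_subgroup])
  have meets: "\<exists>m\<in>M. \<exists>r\<in>carrier R. m \<oplus> r \<otimes> a \<in> S" if a: "a \<in> carrier R" "a \<notin> M" for a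
  proof -
    let ?X = "M <+>\<^bsub>R\<^esub> PIdl a"
    note X_iff = add_cgenideal_mem_iff[OF M(1) a(1)]
    have "ideal ?X R"
      by (rule add_ideals[OF M(1) cgenideal_ideal[OF a(1)]])
    moreover have "M \<subseteq> ?X"
    proof
      fix m assume m: "m \<in> M"
      then have "m = m \<oplus> \<zero> \<otimes> a" using a by (simp add: M.Icarr)
      with m show "m \<in> ?X" unfolding X_iff by blast
    qed
    moreover have "a = \<zero> \<oplus> \<one> \<otimes> a" using a by simp
    then have "a \<in> ?X" unfolding X_iff using zero one_closed by blast
    ultimately have "?X \<inter> S \<noteq> {}" using max a(2) by blast
    then obtain x where "x \<in> ?X" "x \<in> S" by blast
    then show ?thesis unfolding X_iff by blast
  qed
  have "primeideal M R"
  proof (rule primeidealI[OF M(1) is_cring])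
    show "carrier R \<noteq> M" using M(2) S(2) by auto
    fix a b assume ab: "a \<in> carrier R" "b \<in> carrier R" "a \<otimes> b \<in> M"
    show "a \<in> M \<or> b \<in> M"
    proof (rule ccontr)
      assume "\<not> (a \<in> M \<or> b \<in> M)"
      with meets ab obtain m r m' r'
        where m: "m \<in> M" "r \<in> carrier R" "m \<oplus> r \<otimes> a \<in> S"
          and m': "m' \<in> M" "r' \<in> carrier R" "m' \<oplus> r' \<otimes> b \<in> S"
        by meson
      have mc: "m \<in> carrier R" "m' \<in> carrier R" using m(1) m'(1) by (auto intro: M.Icarr)
      \<comment> \<open>The expansion is grouped so that each summand has a factor \<open>m\<close>,
        \<open>m'\<close> or \<open>a \<otimes> b\<close>, all of which lie in
        \<open>M\<close>.\<close>
      have "(m \<oplus> r \<otimes> a) \<otimes> (m' \<oplus> r' \<otimes> b) =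
          m \<otimes> (m' \<oplus> r' \<otimes> b) \<oplus> ((r \<otimes> a) \<otimes> m' \<oplus> (r \<otimes> r') \<otimes> (a \<otimes> b))"
        using ab m(2) m'(2) mc by algebra
      also have "\<dots> \<in> M"
      proof (intro M.a_closed)
        show "m \<otimes> (m' \<oplus> r' \<otimes> b) \<in> M"
          by (rule M.I_r_closed[OF m(1)]) (use ab mc m'(2) in simp)
        show "(r \<otimes> a) \<otimes> m' \<in> M"
          by (rule M.I_l_closed[OF m'(1)]) (use ab m(2) in simp)
        show "(r \<otimes> r') \<otimes> (a \<otimes> b) \<in> M"
          by (rule M.I_l_closed[OF ab(3)]) (use m(2) m'(2) in simp)
      qed
      finally show False using mult[OF m(3) m'(3)] M(2) by blast
    qed
  qed
  then show thesis using M(2) by (rule that)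
qed

lemma (in primeideal) one_not_mem: "\<one> \<notin> I"
  using one_imp_carrier I_notcarr by blast

lemma (in primeideal) one_minus_not_mem:
  assumes "b \<in> I"
  shows "\<one> \<ominus> b \<notin> I"
proof
  assume "\<one> \<ominus> b \<in> I"
  then have "(\<one> \<ominus> b) \<oplus> b \<in> I" using assms by blast
  moreover have "(\<one> \<ominus> b) \<oplus> b = \<one>" using Icarr[OF assms] by algebra
  ultimately show False using one_not_mem by simp
qed

lemma (in primeideal) nilradical_subset: "nilradical R \<subseteq> I"
proof
  fix x assume "x \<in> nilradical R"
  then obtain n :: nat where x: "x \<in> carrier R" "x [^] n = \<zero>"
    unfolding nilradical_def by blast
  \<comment> \<open>Primality strips off one factor \<open>x\<close> at a time; the base case is
    vacuous because \<open>x [^] 0\<close> is 1, which is outside \<open>I\<close>.\<close>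
  have "x [^] k \<in> I \<Longrightarrow> x \<in> I" for k :: nat
    using x(1) one_not_mem by (induction k) (auto dest: I_prime[rotated -1])
  moreover have "x [^] n \<in> I"
    using x(2) additive_subgroup.zero_closed[OF is_additive_subgroup] by simp
  ultimately show "x \<in> I" .
qed

lemma (in cring) minimal_prime_annihilated_power:
  assumes P: "minimal_prime_ideal R P" and a: "a \<in> P"
  obtains s and n :: nat where "s \<in> carrier R" "s \<notin> P" "s \<otimes> a [^] n = \<zero>"
proof (rule ccontr)
  assume contra: "\<not> thesis"
  have "primeideal P R" using P unfolding minimal_prime_ideal_def by blast
  then interpret P: primeideal P R .
  have ac: "a \<in> carrier R" using a by (rule P.Icarr)
  define S where "S = {s \<otimes> a [^] n | s (n::nat). s \<in> carrier R \<and> s \<notin> P}"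
  have S_I: "s \<otimes> a [^] n \<in> S" if "s \<in> carrier R" "s \<notin> P" for s and n :: nat
    using that unfolding S_def by blast
  have "S \<subseteq> carrier R" unfolding S_def using ac by auto
  moreover have "\<one> \<in> S"
    using S_I[of \<one> 0] P.one_not_mem by simp
  \<comment> \<open>Writing 0 as an element of \<open>S\<close> would produce exactly the
    \<open>s\<close> and \<open>n\<close> whose existence is being denied.\<close>
  moreover have "\<zero> \<notin> S"
    using contra that unfolding S_def by force
  moreover have "x \<otimes> y \<in> S" if xy: "x \<in> S" "y \<in> S" for x y
  proof -
    obtain s t and m n :: nat
      where x: "x = s \<otimes> a [^] m" "s \<in> carrier R" "s \<notin> P"
        and y: "y = t \<otimes> a [^] n" "t \<in> carrier R" "t \<notin> P"
      using xy unfolding S_def by blast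
    have "x \<otimes> y = (s \<otimes> t) \<otimes> (a [^] m \<otimes> a [^] n)"
      using x y ac by (simp add: m_ac)
    also have "\<dots> = (s \<otimes> t) \<otimes> a [^] (m + n)"
      using ac by (simp add: nat_pow_mult)
    also have "\<dots> \<in> S"
      using x y P.I_prime by (intro S_I) auto
    finally show ?thesis .
  qed
  ultimately obtain Q where Q: "primeideal Q R" "Q \<inter> S = {}"
    using exists_primeideal_disjoint by blast
  interpret Q: primeideal Q R by (rule Q(1))
  have "Q \<subseteq> P"
  proof
    fix x assume x: "x \<in> Q"
    then have "x \<in> carrier R" by (rule Q.Icarr)
    \<comment> \<open>Exponent 0 places the whole complement of \<open>P\<close> inside
      \<open>S\<close>, so \<open>Q\<close> cannot leave \<open>P\<close>.\<close>
    then show "x \<in> P" using S_I[of x 0] Q(2) x by auto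
  qed
  then have "Q = P" using P Q(1) unfolding minimal_prime_ideal_def by blast
  \<comment> \<open>Taking \<open>s = 1\<close> and exponent 1 puts \<open>a\<close> itself in
    \<open>S\<close>; this is what separates \<open>Q\<close> from \<open>P\<close>.\<close>
  moreover have "a \<in> S" using S_I[of \<one> 1] P.one_not_mem ac by simp
  ultimately show False using a Q(2) by blast
qed

lemma (in primeideal) minimal_prime_if_N_pure:
  assumes "N_pure_ideal R I"
  shows "minimal_prime_ideal R I"
  unfolding minimal_prime_ideal_def
proof (intro conjI allI impI primeideal subset_antisym)
  fix Q assume Q: "primeideal Q R" "Q \<subseteq> I"
  interpret Q: primeideal Q R by (rule Q(1))
  show "I \<subseteq> Q"
  proof
    fix a assume a: "a \<in> I"
    with assms obtain b where b: "b \<in> I" "a \<otimes> (\<one> \<ominus> b) \<in> nilradical R"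
      unfolding N_pure_ideal_def by blast
    have "a \<otimes> (\<one> \<ominus> b) \<in> Q" using b(2) Q.nilradical_subset by blast
    moreover have "\<one> \<ominus> b \<notin> Q" using one_minus_not_mem[OF b(1)] Q(2) by blast
    ultimately show "a \<in> Q" using Q.I_prime a b(1) by (meson Icarr minus_closed one_closed)
  qed
qed

lemma (in cring) nilpotent_mult_if_annihilates_power:
  assumes "a \<in> carrier R" "t \<in> carrier R" "t \<otimes> a [^] (n::nat) = \<zero>"
  shows "a \<otimes> t \<in> nilradical R"
proof -
  \<comment> \<open>The exponent \<open>Suc n\<close> leaves a spare \<open>t\<close> to pair with
    \<open>a [^] n\<close>, even for \<open>n = 0\<close>, where the hypothesis says
    \<open>t = 0\<close>.\<close>
  have "(a \<otimes> t) [^] Suc n = (a \<otimes> t [^] n) \<otimes> (t \<otimes> a [^] n)"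
    using assms(1,2) by (simp add: nat_pow_distrib m_ac)
  then have "(a \<otimes> t) [^] Suc n = \<zero>"
    using assms by simp
  then show ?thesis
    using assms(1,2) unfolding nilradical_def by blast
qed

lemma (in cring) N_pure_if_minimal_prime:
  assumes R: "mid_ring R" and P: "minimal_prime_ideal R P"
  shows "N_pure_ideal R P"
proof -
  have "primeideal P R" using P unfolding minimal_prime_ideal_def by blast
  then interpret P: primeideal P R .
  have "\<exists>b\<in>P. a \<otimes> (\<one> \<ominus> b) \<in> nilradical R" if a: "a \<in> P" for a
  proof -
    have ac: "a \<in> carrier R" using a by (rule P.Icarr)
    obtain s and n :: nat where s: "s \<in> carrier R" "s \<notin> P" "s \<otimes> a [^] n = \<zero>"
      using minimal_prime_annihilated_power[OF P a] .
    have "N_pure_ideal R (annihilator R (a [^] n))"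
      using R ac unfolding mid_ring_def by simp
    moreover have "s \<in> annihilator R (a [^] n)"
      using s unfolding annihilator_def by simp
    ultimately obtain t where t: "t \<in> annihilator R (a [^] n)"
      and st: "s \<otimes> (\<one> \<ominus> t) \<in> nilradical R"
      unfolding N_pure_ideal_def by blast
    have tc: "t \<in> carrier R" "t \<otimes> a [^] n = \<zero>"
      using t unfolding annihilator_def by auto
    \<comment> \<open>The nilpotent \<open>s \<otimes> (\<one> \<ominus> t)\<close> lies in the
      prime \<open>P\<close>, while \<open>s\<close> does not.\<close>
    have "\<one> \<ominus> t \<in> P"
      using st P.nilradical_subset P.I_prime[of s "\<one> \<ominus> t"] s tc by auto
    moreover have "\<one> \<ominus> (\<one> \<ominus> t) = t"
      using tc by algebra
    ultimately show ?thesis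
      using nilpotent_mult_if_annihilates_power[OF ac tc] by (metis (full_types))
  qed
  then show ?thesis
    unfolding N_pure_ideal_def using P.is_ideal by blast
qed

theorem theorem4p14:
  fixes R :: "('a, 'b) ring_scheme" and P :: "'a set"
  assumes "mid_ring R" and "primeideal P R"
  shows "N_pure_ideal R P \<longleftrightarrow> minimal_prime_ideal R P"
proof
  show "minimal_prime_ideal R P" if "N_pure_ideal R P"
    using assms(2) that by (rule primeideal.minimal_prime_if_N_pure)
  have "cring R" using assms(1) unfolding mid_ring_def by blast
  then show "N_pure_ideal R P" if "minimal_prime_ideal R P"
    using assms(1) that by (rule cring.N_pure_if_minimal_prime)
qed

end
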